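(* Let $K\subset L$ be fields and let $T=K+XL[X]$. Let $D$ be a subring of $K$ and let $R=D+XL[X]$. Then: (a) $R$ is atomic if and only if $T$ is atomic and $D$ is a field. (b) $R$ satisfies ACCP if and only if $T$ satisfies ACCP and $D$ is a field.
   Context: All rings are commutative with unity. For $A\subset B$ rings, $A+XB[X]$ denotes the subring of the polynomial ring $B[X]$ consisting of the polynomials whose constant term lies in $A$. An integral domain is atomic if every nonzero noninvertible element is a product of irreducible elements (atoms). An integral domain satisfies ACCP if every increasing sequence of principal ideals is stationary. *)

theory Defs
  imports "HOL-Algebra.Algebra"
begin

text \<open>The ring \<open>A + X B[X]\<close>: the library's polynomial ring \<open>UP B\<close> with its carrier cut
  down to the polynomials with constant term in \<open>A\<close>. The remaining fields of the record are
  inherited from \<open>UP B\<close>; only the ring structure is meaningful (the scalar multiplication of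
  \<open>UP B\<close> need not preserve the smaller carrier).\<close>

definition const_term_poly_ring :: "'a set \<Rightarrow> ('a, 'b) ring_scheme \<Rightarrow> ('a, nat \<Rightarrow> 'a) up_ring"
  where "const_term_poly_ring A B =
    (UP B) \<lparr>carrier := {p \<in> carrier (UP B). coeff (UP B) p 0 \<in> A}\<rparr>"

text \<open>Atoms are \<^const>\<open>ring_irreducible\<close> elements rather than \<^const>\<open>irreducible\<close> ones,
  because the latter admits zero when the ring is a field.\<close>

locale atomic_domain = domain R for R (structure) +
  assumes atomic: "\<lbrakk>a \<in> carrier R; a \<noteq> \<zero>; a \<notin> Units R\<rbrakk> \<Longrightarrow>
    \<exists>fs. set fs \<subseteq> carrier R \<and> (\<forall>x \<in> set fs. ring_irreducible x) \<and> foldr (\<otimes>) fs \<one> = a"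

locale accp_domain = domain R for R (structure) +
  assumes accp: "\<lbrakk>\<And>n. principalideal (I n) R; \<And>n. I n \<subseteq> I (Suc n)\<rbrakk> \<Longrightarrow>
    \<exists>N. \<forall>n\<ge>N. I n = I (N::nat)"

end

theory Submission
  imports Defs
begin

text \<open>If some nonzero \<open>d \<in> D\<close> has no inverse in \<open>D\<close>, then \<open>f = d \<cdot> (d\<^sup>-\<^sup>1 f)\<close> factors every
  polynomial \<open>f\<close> without constant term into nonunits of \<open>R\<close>. So no atom lies in \<open>X L[X]\<close>, and as
  this ideal is prime, \<open>X\<close> is not a product of atoms; moreover the principal ideals generated by
  the \<open>d\<^sup>-\<^sup>n X\<close> form a strictly increasing chain. Conversely, over a subfield of \<open>L\<close> the nonzero
  elements of degree zero are units, so proper divisors have smaller degree, which gives ACCP and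
  atomicity. In particular the conditions on \<open>T\<close> hold automatically.\<close>

text \<open>The coefficient ring \<open>A\<close> enters only as a subring of the field
  \<open>R\<close>, so one locale covers both rings of the theorem: it is interpreted with D and
  with K as \<open>A\<close>, and \<open>T\<close> below stands for either ring.\<close>

locale const_term_poly = UP R P + R?: field R for R (structure) and P (structure) +
  fixes A
  assumes subring_A: "subring A R"
begin

sublocale UP_domain R P
  by intro_locales

abbreviation T where "T \<equiv> const_term_poly_ring A R"

section \<open>The domain \<open>T\<close> and its units\<close>

lemma carrier_T: "carrier T = {p \<in> carrier P. up_ring.coeff P p 0 \<in> A}"
  and T_simps [simp]: 
    "(\<otimes>\<^bsub>T\<^esub>) = (\<otimes>\<^bsub>P\<^esub>)" "\<one>\<^bsub>T\<^esub> = \<one>\<^bsub>P\<^esub>" "\<zero>\<^bsub>T\<^esub> = \<zero>\<^bsub>P\<^esub>" "(\<oplus>\<^bsub>T\<^esub>) = (\<oplus>\<^bsub>P\<^esub>)"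
  by (simp_all add: const_term_poly_ring_def P_def)

lemma T_eq: "T = P\<lparr>carrier := carrier T\<rparr>"
  by (simp add: const_term_poly_ring_def P_def)

lemma coeff_0_mult [simp]:
  "\<lbrakk>p \<in> carrier P; q \<in> carrier P\<rbrakk> \<Longrightarrow>
    up_ring.coeff P (p \<otimes>\<^bsub>P\<^esub> q) 0 = up_ring.coeff P p 0 \<otimes> up_ring.coeff P q 0"
  by simp

lemma domain_T: "domain T"
proof -
  note A = subringE[OF subring_A]
  have "subring (carrier T) P"
    by (rule P.subringI) (use A in \<open>auto simp: carrier_T\<close>)
  then show ?thesis
    using domain.subring_is_domain[OF UP_domain] T_eq by metis
qed

text \<open>The rewrites let facts about \<open>T\<close> speak of the operations of
  \<open>P\<close>, so that the simplification rules for polynomials apply to them.\<close>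

sublocale T: "domain" T
  rewrites
    "(\<otimes>\<^bsub>T\<^esub>) = (\<otimes>\<^bsub>P\<^esub>)" and "\<one>\<^bsub>T\<^esub> = \<one>\<^bsub>P\<^esub>"
    and "\<zero>\<^bsub>T\<^esub> = \<zero>\<^bsub>P\<^esub>" and "(\<oplus>\<^bsub>T\<^esub>) = (\<oplus>\<^bsub>P\<^esub>)"
  by (rule domain_T) simp_all

lemma monom_mem_T: "a \<in> carrier R \<Longrightarrow> (n = 0 \<Longrightarrow> a \<in> A) \<Longrightarrow> up_ring.monom P a n \<in> carrier T"
  using subringE(2)[OF subring_A] by (auto simp: carrier_T)

text \<open>Taking constant terms is multiplicative and maps \<open>T\<close> into \<open>A\<close>.
  Hence the inverse of \<open>p\<close> in \<open>T\<close> has as its constant term the inverse, in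
  the field \<open>R\<close>, of the constant term of \<open>p\<close>.\<close>

lemma coeff_0_Units_T:
  assumes "p \<in> Units T"
  shows "up_ring.coeff P p 0 \<noteq> \<zero>" "inv (up_ring.coeff P p 0) \<in> A"
proof -
  obtain q where q: "q \<in> carrier T" "p \<otimes>\<^bsub>P\<^esub> q = \<one>\<^bsub>P\<^esub>" and p: "p \<in> carrier T"
    using assms by (auto simp: Units_def)
  then have eq: "up_ring.coeff P p 0 \<otimes> up_ring.coeff P q 0 = \<one>"
    using coeff_0_mult[of p q] by (simp add: carrier_T del: coeff_mult)
  then show "up_ring.coeff P p 0 \<noteq> \<zero>"
    using q by (auto simp: carrier_T)
  have "inv (up_ring.coeff P p 0) = up_ring.coeff P q 0"
    using p q eq by (intro R.comm_inv_char) (auto simp: carrier_T)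
  then show "inv (up_ring.coeff P p 0) \<in> A"
    using q by (simp add: carrier_T)
qed

section \<open>Necessity: atomicity or ACCP makes \<open>A\<close> a subfield\<close>

lemma subfieldI_const_units:
  assumes "\<And>d. d \<in> A \<Longrightarrow> d \<noteq> \<zero> \<Longrightarrow> up_ring.monom P d 0 \<in> Units T"
  shows "subfield A R"
proof (rule R.subfieldI'[OF subring_A])
  fix d assume "d \<in> A - {\<zero>}"
  moreover from this have "d \<in> carrier R"
    using subringE(1)[OF subring_A] by auto
  ultimately show "inv d \<in> A"
    using coeff_0_Units_T(2)[OF assms[of d]] by simp
qed

lemma subfield_if_atomic:
  assumes "atomic_domain T"
  shows "subfield A R"
proof (rule subfieldI_const_units, rule ccontr)
  fix d assume d: "d \<in> A" "d \<noteq> \<zero>" and nonunit: "up_ring.monom P d 0 \<notin> Units T"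
  interpret atomic_domain T by fact
  have dR: "d \<in> carrier R" "inv d \<in> carrier R" "d \<otimes> inv d = \<one>"
    using d subringE(1)[OF subring_A] R.field_Units by auto
  have no_atom: "up_ring.coeff P f 0 \<noteq> \<zero>" if f: "f \<in> carrier T" "ring_irreducible\<^bsub>T\<^esub> f" for f
  proof
    assume f0: "up_ring.coeff P f 0 = \<zero>"
    \<comment> \<open>\<open>inv d\<close> need not lie in \<open>A\<close>, but \<open>g\<close>
      inherits the zero constant term of \<open>f\<close> and so belongs to \<open>T\<close> all the
      same.\<close>
    define g where "g = up_ring.monom P (inv d) 0 \<otimes>\<^bsub>P\<^esub> f"
    have fP: "f \<in> carrier P"
      using f by (simp add: carrier_T)
    then have g0: "up_ring.coeff P g 0 = \<zero>"
      using dR f0 by (simp add: g_def)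
    have "g \<in> carrier P"
      using dR fP by (simp add: g_def)
    then have g: "g \<in> carrier T"
      using g0 subringE(2)[OF subring_A] by (simp add: carrier_T)
    have "up_ring.monom P d 0 \<otimes>\<^bsub>P\<^esub> g = (up_ring.monom P d 0 \<otimes>\<^bsub>P\<^esub> up_ring.monom P (inv d) 0) \<otimes>\<^bsub>P\<^esub> f"
      using dR fP by (simp add: g_def P.m_assoc)
    also have "\<dots> = f"
      using dR fP monom_mult[of d "inv d" 0 0, symmetric] by (simp del: monom_mult)
    finally have "f = up_ring.monom P d 0 \<otimes>\<^bsub>P\<^esub> g" ..
    then have "up_ring.monom P d 0 \<in> Units T \<or> g \<in> Units T"
      using T.ring_irreducibleE(5)[OF f monom_mem_T g] d dR by simp
    then show False
      using nonunit g0 coeff_0_Units_T(1) by auto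
  qed
  \<comment> \<open>Constant terms multiply and \<open>R\<close> has no zero divisors, so products
    of atoms keep a nonzero constant term; the empty product has constant term one.\<close>
  have foldr_nonzero: "foldr (\<otimes>\<^bsub>P\<^esub>) fs \<one>\<^bsub>P\<^esub> \<in> carrier P \<and>
      up_ring.coeff P (foldr (\<otimes>\<^bsub>P\<^esub>) fs \<one>\<^bsub>P\<^esub>) 0 \<noteq> \<zero>"
    if "set fs \<subseteq> carrier T" "\<forall>x\<in>set fs. ring_irreducible\<^bsub>T\<^esub> x" for fs
    using that
  proof (induction fs)
    case (Cons f fs)
    then show ?case
      using no_atom[of f] by (auto simp: carrier_T R.integral_iff)
  qed simp
  define x where "x = up_ring.monom P \<one> 1"
  have x: "x \<in> carrier T" "up_ring.coeff P x 0 = \<zero>"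
    by (auto simp: x_def monom_mem_T)
  moreover have "up_ring.coeff P x 1 = \<one>" by (simp add: x_def)
  then have "x \<noteq> \<zero>\<^bsub>P\<^esub>" by auto
  moreover have "x \<notin> Units T"
    using x coeff_0_Units_T(1) by auto
  ultimately show False
    using atomic[of x] foldr_nonzero by auto
qed

text \<open>Turns chains of principal ideals into divisibility; the cofactor lies in
  \<open>T\<close>, so its constant term lies in \<open>A\<close>.\<close>

lemma cgenideal_T_subset_iff:
  assumes "p \<in> carrier T" "q \<in> carrier T"
  shows "PIdl\<^bsub>T\<^esub> p \<subseteq> PIdl\<^bsub>T\<^esub> q \<longleftrightarrow> (\<exists>r\<in>carrier T. p = r \<otimes>\<^bsub>P\<^esub> q)"
proof
  assume "PIdl\<^bsub>T\<^esub> p \<subseteq> PIdl\<^bsub>T\<^esub> q"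
  then show "\<exists>r\<in>carrier T. p = r \<otimes>\<^bsub>P\<^esub> q"
    using T.cgenideal_self[OF assms(1)] by (auto simp: cgenideal_def)
next
  assume "\<exists>r\<in>carrier T. p = r \<otimes>\<^bsub>P\<^esub> q"
  then have "p \<in> PIdl\<^bsub>T\<^esub> q"
    by (auto simp: cgenideal_def)
  then show "PIdl\<^bsub>T\<^esub> p \<subseteq> PIdl\<^bsub>T\<^esub> q"
    using T.cgenideal_minimal[OF T.cgenideal_ideal[OF assms(2)]] by simp
qed

text \<open>The argument is direct: once the chain is stationary, two consecutive generators differ
  by a cofactor in \<open>T\<close>, and the constant term of this cofactor is
  \<open>inv d\<close>.\<close>

lemma subfield_if_accp:
  assumes "accp_domain T"
  shows "subfield A R"
proof (rule R.subfieldI'[OF subring_A])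
  fix d assume d: "d \<in> A - {\<zero>}"
  interpret accp_domain T by fact
  have dR: "d \<in> carrier R" "inv d \<in> carrier R" "d \<otimes> inv d = \<one>"
    using d subringE(1)[OF subring_A] R.field_Units by auto
  define q where "q n = up_ring.monom P (inv d [^] n) 1" for n :: nat
  have q: "q n \<in> carrier T" for n
    using dR by (simp add: q_def monom_mem_T)
  have "q n = up_ring.monom P d 0 \<otimes>\<^bsub>P\<^esub> q (Suc n)" for n
  proof -
    have "inv d [^] n = d \<otimes> inv d [^] Suc n"
      using dR R.m_lcomm[of d "inv d [^] n" "inv d"] by simp
    then show ?thesis
      using dR monom_mult[of d "inv d [^] Suc n" 0 1] unfolding q_def by simp
  qed
  then have "PIdl\<^bsub>T\<^esub> (q n) \<subseteq> PIdl\<^bsub>T\<^esub> (q (Suc n))" for n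
    unfolding cgenideal_T_subset_iff[OF q q] using d dR monom_mem_T by blast
  then obtain N where "\<forall>n\<ge>N. PIdl\<^bsub>T\<^esub> (q n) = PIdl\<^bsub>T\<^esub> (q N)"
    using accp[of "\<lambda>n. PIdl\<^bsub>T\<^esub> (q n)"] T.cgenideal_is_principalideal[OF q] by auto
  then have "PIdl\<^bsub>T\<^esub> (q (Suc N)) \<subseteq> PIdl\<^bsub>T\<^esub> (q N)"
    by (metis le_SucI order_refl)
  then obtain r where r: "r \<in> carrier T" "q (Suc N) = r \<otimes>\<^bsub>P\<^esub> q N"
    unfolding cgenideal_T_subset_iff[OF q q] by blast
  have rP: "r \<in> carrier P" "up_ring.coeff P r 0 \<in> A"
    using r by (auto simp: carrier_T)
  \<comment> \<open>As \<open>q N\<close> is a scalar multiple of X, only the constant term of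
    \<open>r\<close> contributes to the coefficient of X in the product; it remains to cancel
    \<open>inv d [^] N\<close>.\<close>
  have "inv d [^] Suc N = up_ring.coeff P (q (Suc N)) 1"
    using dR by (simp add: q_def)
  also have "\<dots> = up_ring.coeff P r 0 \<otimes> inv d [^] N"
    using rP dR r(2) by (simp add: q_def)
  finally have "inv d [^] N \<otimes> inv d = inv d [^] N \<otimes> up_ring.coeff P r 0"
    using rP dR by (simp add: R.m_comm)
  moreover have "inv d \<noteq> \<zero>"
    using dR by auto
  then have "inv d [^] N \<noteq> \<zero>"
    using dR R.field_Units R.Units_pow_closed[of "inv d" N] by auto
  ultimately have "inv d = up_ring.coeff P r 0"
    using R.m_lcancel rP dR by simp
  then show "inv d \<in> A"
    using rP by simp
qed

section \<open>Sufficiency: a subfield \<open>A\<close> gives atomicity and ACCP\<close>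

context
  assumes subfield_A: "subfield A R"
begin

text \<open>Degree zero reduces \<open>p\<close> to its constant term, a nonzero element of
  \<open>A\<close>; as \<open>A\<close> is a field, the inverse is again a constant from
  \<open>A\<close> and thus lies in \<open>T\<close>.\<close>

lemma deg_0_Units_T:
  assumes p: "p \<in> carrier T" "p \<noteq> \<zero>\<^bsub>P\<^esub>" "deg R p = 0"
  shows "p \<in> Units T"
proof -
  obtain a where a: "a \<in> A" "p = up_ring.monom P a 0"
    using p deg_zero_impl_monom[of p] by (auto simp: carrier_T)
  moreover from this have "a \<noteq> \<zero>"
    using p(2) by auto
  ultimately have "a \<in> Units (R\<lparr>carrier := A\<rparr>)"
    using subfield.subfield_Units[OF subfield_A] by simp
  then obtain b where b: "b \<in> A" "a \<otimes> b = \<one>"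
    by (auto simp: Units_def)
  have R: "a \<in> carrier R" "b \<in> carrier R"
    using a b subringE(1)[OF subring_A] by auto
  then have "p \<otimes>\<^bsub>P\<^esub> up_ring.monom P b 0 = \<one>\<^bsub>P\<^esub>"
    using a b monom_mult[of a b 0 0, symmetric] by (simp del: monom_mult)
  moreover have "up_ring.monom P b 0 \<in> carrier T"
    using R b by (simp add: monom_mem_T)
  ultimately show ?thesis
    using p(1) T.m_comm[of p] T.unit_factor[of p "up_ring.monom P b 0"] by simp
qed

lemma atomic_if_subfield: "atomic_domain T"
proof (intro atomic_domain.intro atomic_domain_axioms.intro domain_T)
  fix a
  assume "a \<in> carrier T" "a \<noteq> \<zero>\<^bsub>T\<^esub>" "a \<notin> Units T"
  then show "\<exists>fs. set fs \<subseteq> carrier T \<and> (\<forall>x\<in>set fs. ring_irreducible\<^bsub>T\<^esub> x) \<and>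
      foldr (\<otimes>\<^bsub>T\<^esub>) fs \<one>\<^bsub>T\<^esub> = a"
  proof (induction "deg R a" arbitrary: a rule: less_induct)
    case less
    show ?case
    proof (cases "ring_irreducible\<^bsub>T\<^esub> a")
      case True
      with less.prems show ?thesis
        by (intro exI[of _ "[a]"]) simp
    next
      case False
      then obtain b c where bc: "b \<in> carrier T" "c \<in> carrier T" "a = b \<otimes>\<^bsub>P\<^esub> c"
          "b \<notin> Units T" "c \<notin> Units T"
        using T.ring_irreducibleI[of a] less.prems by auto
      have P: "b \<in> carrier P" "c \<in> carrier P"
        using bc by (auto simp: carrier_T)
      have nz: "b \<noteq> \<zero>\<^bsub>P\<^esub>" "c \<noteq> \<zero>\<^bsub>P\<^esub>"
        using P less.prems bc(3) by auto
      have "deg R a = deg R b + deg R c"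
        using nz P bc(3) by simp
      \<comment> \<open>Both factors are nonzero nonunits, so neither is constant, and by additivity
        of the degree both have smaller degree than \<open>a\<close>.\<close>
      moreover have "deg R b \<noteq> 0" "deg R c \<noteq> 0"
        using deg_0_Units_T bc nz by blast+
      ultimately have "deg R b < deg R a" "deg R c < deg R a"
        by auto
      then obtain fs gs where fs: "set fs \<subseteq> carrier T" "\<forall>x\<in>set fs. ring_irreducible\<^bsub>T\<^esub> x"
          "foldr (\<otimes>\<^bsub>P\<^esub>) fs \<one>\<^bsub>P\<^esub> = b"
        and gs: "set gs \<subseteq> carrier T" "\<forall>x\<in>set gs. ring_irreducible\<^bsub>T\<^esub> x"
          "foldr (\<otimes>\<^bsub>P\<^esub>) gs \<one>\<^bsub>P\<^esub> = c"
        using less.hyps[of b] less.hyps[of c] bc nz by auto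
      \<comment> \<open>Folding over \<open>fs @ gs\<close> starts the fold over \<open>fs\<close>
        from \<open>c\<close> instead of one; associativity identifies the result with the product
        of \<open>b\<close> and \<open>c\<close>.\<close>
      have "foldr (\<otimes>\<^bsub>P\<^esub>) fs \<one>\<^bsub>P\<^esub> \<in> carrier P \<and>
          foldr (\<otimes>\<^bsub>P\<^esub>) fs c = foldr (\<otimes>\<^bsub>P\<^esub>) fs \<one>\<^bsub>P\<^esub> \<otimes>\<^bsub>P\<^esub> c"
        using fs(1) P(2) by (induction fs) (auto simp: carrier_T P.m_assoc)
      with fs gs bc(3) show ?thesis
        by (intro exI[of _ "fs @ gs"]) auto
    qed
  qed
qed

lemma accp_if_subfield: "accp_domain T"
proof (intro accp_domain.intro accp_domain_axioms.intro domain_T)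
  fix I :: "nat \<Rightarrow> (nat \<Rightarrow> 'a) set"
  assume princ: "\<And>n. principalideal (I n) T" and inc: "\<And>n. I n \<subseteq> I (Suc n)"
  have mono: "I m \<subseteq> I n" if "m \<le> n" for m n
    using lift_Suc_mono_le[of I, OF inc that] .
  have "\<exists>p. p \<in> carrier T \<and> I n = PIdl\<^bsub>T\<^esub> p" for n
    using principalideal.generate[OF princ[of n]] T.cgenideal_eq_genideal by auto
  then obtain p where p: "\<And>n. p n \<in> carrier T" "\<And>n. I n = PIdl\<^bsub>T\<^esub> (p n)"
    by metis
  have pP: "p n \<in> carrier P" for n
    using p(1) by (auto simp: carrier_T)
  have dvd: "\<exists>r\<in>carrier T. p m = r \<otimes>\<^bsub>P\<^esub> p n" if "m \<le> n" for m n
    using mono[OF that] unfolding p(2) cgenideal_T_subset_iff[OF p(1) p(1)] .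
  show "\<exists>N. \<forall>n\<ge>N. I n = I N"
  proof (cases "\<forall>n. p n = \<zero>\<^bsub>P\<^esub>")
    case True
    then show ?thesis by (auto simp: p(2))
  next
    case False
    \<comment> \<open>A nonzero generator of least degree: each later generator divides it, hence is
      nonzero and of the same degree, so the cofactor has degree zero and is a unit.\<close>
    define N where "N = (ARG_MIN (\<lambda>n. deg R (p n)) n. p n \<noteq> \<zero>\<^bsub>P\<^esub>)"
    have N: "p N \<noteq> \<zero>\<^bsub>P\<^esub>" and min: "\<And>n. p n \<noteq> \<zero>\<^bsub>P\<^esub> \<Longrightarrow> deg R (p N) \<le> deg R (p n)"
      using False arg_min_nat_lemma[of "\<lambda>n. p n \<noteq> \<zero>\<^bsub>P\<^esub>" _ "\<lambda>n. deg R (p n)"]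
      unfolding N_def by blast+
    have "I n \<subseteq> I N" if Nn: "N \<le> n" for n
    proof -
      obtain r where r: "r \<in> carrier T" "p N = r \<otimes>\<^bsub>P\<^esub> p n"
        using dvd[OF Nn] by blast
      have rP: "r \<in> carrier P"
        using r by (simp add: carrier_T)
      have nz: "r \<noteq> \<zero>\<^bsub>P\<^esub>" "p n \<noteq> \<zero>\<^bsub>P\<^esub>"
        using N r(2) rP pP[of n] by auto
      then have "deg R (p N) = deg R r + deg R (p n)"
        using rP pP r(2) by simp
      then have "deg R r = 0"
        using min[OF nz(2)] by simp
      then have "r \<in> Units T"
        using deg_0_Units_T r(1) nz(1) by blast
      then obtain s where s: "s \<in> carrier T" "s \<otimes>\<^bsub>P\<^esub> r = \<one>\<^bsub>P\<^esub>"
        by (auto simp: Units_def)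
      have "p n = s \<otimes>\<^bsub>P\<^esub> p N"
        using s r p(1)[of n] T.m_assoc[of s r "p n"] by simp
      then show ?thesis
        unfolding p(2) cgenideal_T_subset_iff[OF p(1) p(1)] using s(1) by blast
    qed
    then show ?thesis
      using mono by blast
  qed
qed

end

section \<open>The criterion for \<open>A\<close>, applied to D and K\<close>

lemma atomic_T_iff: "atomic_domain T \<longleftrightarrow> subfield A R"
  using subfield_if_atomic atomic_if_subfield by blast

lemma accp_T_iff: "accp_domain T \<longleftrightarrow> subfield A R"
  using subfield_if_accp accp_if_subfield by blast

end

theorem proposition2p1:
  fixes L :: "('a, 'b) ring_scheme" and K D :: "'a set"
  assumes "field L"
    and "subfield K L"
    and "subring D (L\<lparr>carrier := K\<rparr>)"
  shows "(atomic_domain (const_term_poly_ring D L) \<longleftrightarrow>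
            atomic_domain (const_term_poly_ring K L) \<and> field (L\<lparr>carrier := D\<rparr>))
       \<and> (accp_domain (const_term_poly_ring D L) \<longleftrightarrow>
            accp_domain (const_term_poly_ring K L) \<and> field (L\<lparr>carrier := D\<rparr>))"
proof -
  interpret L: field L by fact
  have "D \<subseteq> K"
    using subringE(1)[OF assms(3)] by simp
  then have DL: "D \<subseteq> carrier L"
    using subfieldE(3)[OF assms(2)] by blast
  interpret LK: ring "L\<lparr>carrier := K\<rparr>"
    using L.subring_is_ring[OF subfieldE(1)[OF assms(2)]] .
  have "subring D L"
    using LK.subring_is_ring[OF assms(3)] L.subring_iff[OF DL] by simp
  then interpret D: const_term_poly L "UP L" D
    by (intro const_term_poly.intro const_term_poly_axioms.intro assms(1))
  interpret K: const_term_poly L "UP L" K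
    by (intro const_term_poly.intro const_term_poly_axioms.intro assms(1) subfieldE(1)[OF assms(2)])
  have "field (L\<lparr>carrier := D\<rparr>) \<longleftrightarrow> subfield D L"
    using L.subfield_iff DL by blast
  \<comment> \<open>Since \<open>K\<close> is a subfield, its ring is atomic and satisfies ACCP;
    both sides of each equivalence then say that \<open>D\<close> is a subfield of
    \<open>L\<close>.\<close>
  then show ?thesis
    using assms(2) D.atomic_T_iff D.accp_T_iff K.atomic_T_iff K.accp_T_iff by blast
qed

end
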